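(* For $m\ge0$ let $R_m(u):=\sum_{r=0}^{m}\binom{m}{r}d_{m-r}u^r$. Then for every $n\ge 0$, as polynomials in $u,t$, $$\sum_{\alpha\in\mathrm{UPF}_n}u^{\operatorname{fix}(\alpha)}t^{D(\alpha)}=\sum_{m=0}^{n}S(n,m)\,t^{n-m}R_m(u),$$ and, as formal power series in $x$ with coefficients polynomial in $u$, $$\sum_{n\ge0}\ \sum_{\alpha\in\mathrm{UPF}_n}u^{\operatorname{fix}(\alpha)}\frac{x^n}{n!}=\frac{e^{(u-1)(e^x-1)}}{2-e^x}.$$ Setting $u=0$ in the latter gives $\sum_{n\ge0}\widetilde F_n\frac{x^n}{n!}=\frac{e^{1-e^x}}{2-e^x}$, and setting $u=1$ gives $\sum_{n\ge0}F_n\frac{x^n}{n!}=\frac{1}{2-e^x}$.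
   Context: $[n]=\{1,\dots,n\}$. $S(n,m)$ is the Stirling number of the second kind, $d_k$ is the number of derangements of $[k]$ ($d_0=1$), $F_n=\sum_{k=0}^n k!\,S(n,k)$ (Fubini number), and $\widetilde F_n=\sum_{k=0}^n d_k S(n,k)$ (deranged Bell number). A tuple $\alpha=(a_1,\dots,a_n)\in[n]^n$ is a parking function if, when cars $1,\dots,n$ enter in this order a one-way street with spots $1,\dots,n$ and car $i$ parks in the first free spot $s_i\ge a_i$, all cars manage to park. Its displacement is $D(\alpha)=\sum_i(s_i-a_i)$. $\mathrm{UPF}_n$ (unit-interval parking functions) is the set of parking functions of length $n$ with $s_i-a_i\in\{0,1\}$ for all $i$; $\mathrm{UPF}_0$ consists of the empty tuple. Block structure: for $\alpha\in\mathrm{UPF}_n$ let $(a^\uparrow_1,\dots,a^\uparrow_n)$ be its weakly increasing rearrangement, let $\nu_1<\dots<\nu_m$ be the indices $i$ with $a^\uparrow_i=i$, and put $\nu_{m+1}=n+1$. The car set of block $j$ is $I_j=\{i\in[n]:\nu_j\le a_i<\nu_{j+1}\}$. Set $\phi(\alpha)=(I_1,\dots,I_m)$, an ordered set partition of $[n]$. For an ordered set partition $(C_1,\dots,C_k)$ of $[n]$ whose blocks listed by increasing minimum element are $B_1,\dots,B_k$, the block $C_i$ is fixed if $C_i=B_i$. $\operatorname{fix}(\alpha)$ is the number of fixed blocks of $\phi(\alpha)$. *)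

theory Defs
  imports
    "HOL-Computational_Algebra.Formal_Power_Series"
    "HOL-Computational_Algebra.Polynomial"
    "HOL-Combinatorics.Permutations"
    "HOL-Combinatorics.Stirling"
begin

definition derangements :: "nat \<Rightarrow> nat" where
  "derangements k = card {p. p permutes {1..k} \<and> (\<forall>i\<in>{1..k}. p i \<noteq> i)}"

definition Fubini :: "nat \<Rightarrow> nat" where
  "Fubini n = (\<Sum>k=0..n. fact k * Stirling n k)"

definition deranged_Bell :: "nat \<Rightarrow> nat" where
  "deranged_Bell n = (\<Sum>k=0..n. derangements k * Stirling n k)"

definition R :: "nat \<Rightarrow> 'a::comm_ring_1 \<Rightarrow> 'a" where
  "R m u = (\<Sum>r=0..m. of_nat (m choose r) * of_nat (derangements (m - r)) * u ^ r)"


text \<open>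
  Tuples are lists, so the 1-based entry \<open>a\<^sub>i\<close> is \<open>\<alpha> ! (i - 1)\<close>; spots keep their
  names \<open>1, \<dots>, n\<close>. In \<open>park n occ \<alpha>\<close> the cars with preferences \<open>\<alpha>\<close> enter, in this order, a
  street with spots \<open>1, \<dots>, n\<close> of which those in \<open>occ\<close> are taken; the result is the list of
  spots they park in, or \<open>None\<close> if some car fails to park.
\<close>

fun park :: "nat \<Rightarrow> nat set \<Rightarrow> nat list \<Rightarrow> nat list option" where
  "park n occ [] = Some []"
| "park n occ (a # as) =
     (let free = {s \<in> {1..n}. a \<le> s \<and> s \<notin> occ} in
      if free = {} then None
      else map_option ((#) (Min free)) (park n (insert (Min free) occ) as))"

definition parking_function :: "nat \<Rightarrow> nat list \<Rightarrow> bool" where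
  "parking_function n \<alpha> \<longleftrightarrow>
     length \<alpha> = n \<and> set \<alpha> \<subseteq> {1..n} \<and> park n {} \<alpha> \<noteq> None"

definition spots :: "nat list \<Rightarrow> nat list" where
  "spots \<alpha> = the (park (length \<alpha>) {} \<alpha>)"

text \<open>
  The subtractions below are on natural numbers, but a car never parks before its preferred
  spot, so they are not truncated for parking functions.
\<close>

definition displacement :: "nat list \<Rightarrow> nat" where
  "displacement \<alpha> = (\<Sum>i<length \<alpha>. spots \<alpha> ! i - \<alpha> ! i)"

definition UPF :: "nat \<Rightarrow> nat list set" where
  "UPF n = {\<alpha>. parking_function n \<alpha> \<and> (\<forall>i<n. spots \<alpha> ! i - \<alpha> ! i \<in> {0, 1})}"


text \<open>The list \<open>\<nu>\<^sub>1, \<dots>, \<nu>\<^sub>m\<close>, without the sentinel \<open>\<nu>\<^sub>m\<^sub>+\<^sub>1 = n + 1\<close>.\<close>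

definition block_starts :: "nat list \<Rightarrow> nat list" where
  "block_starts \<alpha> = filter (\<lambda>i. sort \<alpha> ! (i - 1) = i) [1..<length \<alpha> + 1]"

definition blocks :: "nat list \<Rightarrow> nat set list" where
  "blocks \<alpha> =
     (let n = length \<alpha>; m = length (block_starts \<alpha>); \<nu> = block_starts \<alpha> @ [n + 1]
      in map (\<lambda>j. {i \<in> {1..n}. \<nu> ! j \<le> \<alpha> ! (i - 1) \<and> \<alpha> ! (i - 1) < \<nu> ! (j + 1)}) [0..<m])"

definition num_fixed_blocks :: "nat set list \<Rightarrow> nat" where
  "num_fixed_blocks C = card {i. i < length C \<and> C ! i = sort_key Min C ! i}"

definition fix_stat :: "nat list \<Rightarrow> nat" where
  "fix_stat \<alpha> = num_fixed_blocks (blocks \<alpha>)"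


definition fps_map :: "('a \<Rightarrow> 'b) \<Rightarrow> 'a fps \<Rightarrow> 'b fps" where
  "fps_map f A = Abs_fps (\<lambda>n. f (fps_nth A n))"

text \<open>
  The embedding of \<open>\<rat>[[x]]\<close> into \<open>\<rat>[u][[x]]\<close>. It is needed because \<open>fps_exp\<close> and the division
  of power series are only available over fields: \<open>e\<^sup>x\<close> and \<open>1 / (2 - e\<^sup>x)\<close> are formed in
  \<open>\<rat>[[x]]\<close> and then embedded, and \<open>e\<^sup>G\<close>, for \<open>G\<close> in \<open>\<rat>[u][[x]]\<close> without constant term, is the
  composition of the embedded exponential series with \<open>G\<close>.
\<close>

definition embed_fps :: "rat fps \<Rightarrow> rat poly fps" where
  "embed_fps = fps_map (\<lambda>c. [:c:])"

definition UPF_egf :: "rat poly fps" where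
  "UPF_egf = Abs_fps (\<lambda>n. smult (1 / fact n) (\<Sum>\<alpha>\<in>UPF n. [:0, 1:] ^ fix_stat \<alpha>))"

end

theory Submission
  imports Defs "HOL-Library.Disjoint_Sets" "HOL-Combinatorics.Multiset_Permutations"
begin

unbundle fps_syntax

text \<open>
  Cut the street in front of every spot whose car is parked where it wanted. Within such a run the
  cars are in increasing order, since each of them found its preferred spot occupied by its left
  neighbour, and the preferences are \<open>p, p, p + 1, p + 2, \<dots>\<close>. Hence the runs are the blocks, a unit
  interval parking function is the same thing as an ordered set partition of \<open>[n]\<close>, and its
  displacement is \<open>n\<close> minus the number of blocks.

  Ordering the blocks of a fixed set partition with \<open>m\<close> blocks amounts to choosing a permutation of
  \<open>m\<close> objects, whose fixed points are the fixed blocks; summing \<open>u ^ fix\<close> over permutations gives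
  \<open>R m u\<close>, and there are \<open>Stirling n m\<close> such set partitions. The exponential generating function of
  \<open>R m u\<close> is \<open>exp ((u - 1) * y) / (1 - y)\<close>, in which the Stirling numbers substitute \<open>y = e\<^sup>x - 1\<close>.
  Identities over \<open>\<rat>[u]\<close> are checked by evaluating at every rational value of \<open>u\<close>.
\<close>

subsection \<open>Permutations and fixed points\<close>

lemma card_derangements:
  assumes "finite A"
  shows "card {p. p permutes A \<and> (\<forall>x\<in>A. p x \<noteq> x)} = derangements (card A)"
proof -
  from assms obtain f where "bij_betw f A {1..card A}"
    by (metis card_atLeastAtMost diff_Suc_1 finite_atLeastAtMost finite_same_card_bij)
  from bij_betw_same_card[OF bij_betw_derangements[OF this]] show ?thesis
    by (simp add: derangements_def)
qed

text \<open>A permutation of \<open>A\<close> whose fixed point set is exactly \<open>T\<close> is a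
  derangement of \<open>A - T\<close>, extended by the identity on \<open>T\<close>.\<close>

lemma card_permutes_fixpoints:
  assumes "finite A" "T \<subseteq> A"
  shows "card {p. p permutes A \<and> {x\<in>A. p x = x} = T} = derangements (card A - card T)"
proof -
  have "{p. p permutes A \<and> {x\<in>A. p x = x} = T} = {p. p permutes (A - T) \<and> (\<forall>x\<in>A - T. p x \<noteq> x)}"
    (is "?l = ?r")
  proof (intro equalityI subsetI)
    fix p assume p: "p \<in> ?l"
    hence "p permutes A" "\<And>x. x \<in> A - (A - T) \<Longrightarrow> p x = x" by auto
    hence "p permutes (A - T)" by (rule permutes_superset)
    with p show "p \<in> ?r" by auto
  next
    fix p assume p: "p \<in> ?r"
    hence "p permutes (A - T)" by simp
    hence "p permutes A" by (rule permutes_subset) simp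
    moreover have "p x = x" if "x \<in> T" for x using that by (intro permutes_not_in[OF \<open>p permutes (A - T)\<close>]) simp
    moreover have "p x \<noteq> x" if "x \<in> A - T" for x using p that by auto
    ultimately show "p \<in> ?l" using assms by auto
  qed
  thus ?thesis using card_derangements[of "A - T"] assms by (simp add: card_Diff_subset finite_subset)
qed

text \<open>Permutations are grouped by their fixed point set, and these sets by their size
  \<open>r\<close>. The binomial coefficient in \<open>R\<close> counts the sets, the derangement
  number the permutations belonging to each.\<close>

lemma sum_power_fixpoints:
  fixes u :: "'a :: comm_ring_1"
  assumes "finite A"
  shows "(\<Sum>p | p permutes A. u ^ card {x\<in>A. p x = x}) = R (card A) u"
proof -
  let ?F = "\<lambda>p. {x\<in>A. p x = x}"
  have "(\<Sum>p | p permutes A. u ^ card (?F p)) =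
        (\<Sum>T\<in>Pow A. \<Sum>p | p \<in> {p. p permutes A} \<and> ?F p = T. u ^ card (?F p))"
    by (intro sum.group[symmetric]) (auto simp: assms finite_permutations)
  also have "\<dots> = (\<Sum>T\<in>Pow A. of_nat (derangements (card A - card T)) * u ^ card T)"
    by (intro sum.cong refl) (simp add: card_permutes_fixpoints assms cong: conj_cong)
  also have "\<dots> = (\<Sum>r=0..card A. \<Sum>T | T \<in> Pow A \<and> card T = r.
                     of_nat (derangements (card A - card T)) * u ^ card T)"
    by (intro sum.group[symmetric]) (auto simp: assms card_mono)
  also have "\<dots> = (\<Sum>r=0..card A. of_nat (card A choose r) * of_nat (derangements (card A - r)) * u ^ r)"
    by (intro sum.cong refl) (simp add: n_subsets assms mult.assoc)
  finally show ?thesis by (simp add: R_def)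
qed

lemma R_1: "R m (1 :: 'a :: comm_ring_1) = of_nat (fact m)"
  using sum_power_fixpoints[of "{1..m}" "1::'a"] by (simp add: card_permutations)

lemma R_0: "R m (0 :: 'a :: comm_ring_1) = of_nat (derangements m)"
proof -
  have "R m (0 :: 'a) = (\<Sum>r\<in>{0}. of_nat (m choose r) * of_nat (derangements (m - r)) * 0 ^ r)"
    unfolding R_def by (rule sum.mono_neutral_right) (auto simp: power_0_left)
  thus ?thesis by simp
qed

section \<open>Reorderings of a list and the positions they keep\<close>

lemma bij_betw_permute_list:
  assumes "distinct xs"
  shows "bij_betw (\<lambda>p. permute_list p xs) {p. p permutes {..<length xs}} (permutations_of_set (set xs))"
proof (rule bij_betw_imageI)
  show "inj_on (\<lambda>p. permute_list p xs) {p. p permutes {..<length xs}}"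
  proof (rule inj_onI; clarify)
    fix p q assume p: "p permutes {..<length xs}" and q: "q permutes {..<length xs}"
      and eq: "permute_list p xs = permute_list q xs"
    show "p = q"
    proof
      fix i show "p i = q i"
      proof (cases "i < length xs")
        case True
        with eq have "xs ! p i = xs ! q i" by (metis p q permute_list_nth)
        moreover have "p i < length xs" "q i < length xs"
          using True p q by (auto dest: permutes_in_image)
        ultimately show ?thesis using assms by (simp add: nth_eq_iff_index_eq)
      qed (use p q in \<open>auto simp: permutes_def\<close>)
    qed
  qed
  show "(\<lambda>p. permute_list p xs) ` {p. p permutes {..<length xs}} = permutations_of_set (set xs)"
  proof (intro equalityI subsetI)
    fix ys assume "ys \<in> permutations_of_set (set xs)"
    hence "mset ys = mset xs" using assms by (auto simp: permutations_of_set_def set_eq_iff_mset_eq_distinct)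
    then obtain p where "p permutes {..<length xs}" "permute_list p xs = ys"
      using mset_eq_permutation by metis
    thus "ys \<in> (\<lambda>p. permute_list p xs) ` {p. p permutes {..<length xs}}" by blast
  qed (use assms in \<open>auto simp: permutations_of_set_def\<close>)
qed

text \<open>As the entries of \<open>xs\<close> are distinct, \<open>permute_list p xs\<close>
  agrees with \<open>xs\<close> at position \<open>i\<close> exactly when
  \<open>p i = i\<close>.\<close>

lemma sum_power_common_positions:
  fixes u :: "'a :: comm_ring_1"
  assumes "distinct xs"
  shows "(\<Sum>ys\<in>permutations_of_set (set xs). u ^ card {i. i < length ys \<and> ys ! i = xs ! i}) = R (length xs) u"
proof -
  have "(\<Sum>ys\<in>permutations_of_set (set xs). u ^ card {i. i < length ys \<and> ys ! i = xs ! i}) =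
        (\<Sum>p | p permutes {..<length xs}. u ^ card {i. i < length xs \<and> permute_list p xs ! i = xs ! i})"
    by (subst sum.reindex_bij_betw[OF bij_betw_permute_list[OF assms], symmetric]) simp
  also have "\<dots> = (\<Sum>p | p permutes {..<length xs}. u ^ card {i\<in>{..<length xs}. p i = i})"
  proof (intro sum.cong refl arg_cong[where f = "\<lambda>A. u ^ card A"] Collect_cong)
    fix p i assume "p \<in> {p. p permutes {..<length xs}}"
    thus "i < length xs \<and> permute_list p xs ! i = xs ! i \<longleftrightarrow> i \<in> {..<length xs} \<and> p i = i"
      using permutes_in_image[of p "{..<length xs}" i] assms
      by (auto simp: permute_list_nth nth_eq_iff_index_eq)
  qed
  finally show ?thesis using sum_power_fixpoints[of "{..<length xs}" u] by simp
qed

text \<open>Since \<open>sort_key\<close> is stable, ties would make the result depend on the order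
  of the input. An injective key leaves no ties.\<close>

lemma sort_key_eq_if_inj_on:
  assumes "distinct xs" "distinct ys" "set xs = set ys" "inj_on f (set ys)"
  shows "sort_key f xs = sort_key f ys"
proof (rule map_inj_on)
  show "map f (sort_key f xs) = map f (sort_key f ys)"
    using assms by (intro sorted_distinct_set_unique) (auto simp: distinct_map)
qed (use assms in auto)

text \<open>Distinct minima make \<open>sort_key Min C\<close> the same list for every ordering
  \<open>C\<close> of \<open>P\<close>. Fixed blocks are thus agreements with one common reference
  list.\<close>

lemma sum_power_num_fixed_blocks:
  fixes u :: "'a :: comm_ring_1"
  assumes "finite P" "inj_on Min P"
  shows "(\<Sum>C\<in>permutations_of_set P. u ^ num_fixed_blocks C) = R (card P) u"
proof -
  from assms obtain xs where xs: "set xs = P" "distinct xs"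
    using finite_distinct_list by blast
  have "(\<Sum>C\<in>permutations_of_set P. u ^ num_fixed_blocks C) =
    (\<Sum>C\<in>permutations_of_set (set (sort_key Min xs)). u ^ card {i. i < length C \<and> C ! i = sort_key Min xs ! i})"
  proof (intro sum.cong)
    fix C assume "C \<in> permutations_of_set (set (sort_key Min xs))"
    hence "sort_key Min C = sort_key Min xs"
      using xs assms by (intro sort_key_eq_if_inj_on) (auto simp: permutations_of_set_def)
    thus "u ^ num_fixed_blocks C = u ^ card {i. i < length C \<and> C ! i = sort_key Min xs ! i}"
      by (simp add: num_fixed_blocks_def)
  qed (use xs in auto)
  also have "\<dots> = R (card P) u"
    using sum_power_common_positions[of "sort_key Min xs" u] xs by (simp add: distinct_card[symmetric])
  finally show ?thesis .
qed

subsection \<open>Set partitions\<close>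

text \<open>A common minimum would lie in two disjoint blocks. Besides making the sorted order of
  the blocks unambiguous, this bounds their number by \<open>card A\<close>.\<close>

lemma inj_on_Min_partition_on:
  assumes "finite A" "partition_on A P"
  shows "inj_on Min P"
proof (rule inj_onI)
  fix X Y assume XY: "X \<in> P" "Y \<in> P" "Min X = Min Y"
  hence "finite X" "X \<noteq> {}" "finite Y" "Y \<noteq> {}"
    using assms by (auto simp: partition_on_def intro: finite_subset)
  hence "Min X \<in> X" "Min X \<in> Y" using XY by (metis Min_in)+
  thus "X = Y" using assms XY by (auto simp: partition_on_def disjoint_def)
qed

text \<open>The recurrence of the Stirling numbers is matched by looking at the block of a new
  element \<open>a\<close>: either it is \<open>{a}\<close>, or it arises by adding \<open>a\<close>
  to one of the \<open>k\<close> blocks of a partition of \<open>A\<close>.\<close>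

lemma card_partition_on_Stirling:
  assumes "finite A"
  shows "card {P. partition_on A P \<and> card P = k} = Stirling (card A) k"
  using assms
proof (induction A arbitrary: k rule: finite_induct)
  case empty
  have "{P::'a set set. partition_on {} P \<and> card P = k} = (if k = 0 then {{}} else {})"
    by (auto simp: partition_on_empty)
  thus ?case by (cases k) (simp_all del: empty_Collect_eq Collect_empty_eq)
next
  case (insert a A)
  let ?Q = "\<lambda>k. {P. partition_on A P \<and> card P = k}"
  show ?case
  proof (cases k)
    case 0
    have "P \<noteq> {}" "finite P" if "partition_on (insert a A) P" for P
      using that finite_elements[of "insert a A" P] insert.hyps by (auto simp: partition_on_def)
    hence "{P. partition_on (insert a A) P \<and> card P = k} = {}" using 0 by (auto simp: card_gt_0_iff)
    thus ?thesis using 0 insert.hyps by (metis Stirling.simps(3) card.empty card_insert_disjoint)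
  next
    case (Suc l)
    \<comment> \<open>\<open>?f\<close> adds \<open>a\<close> to the chosen block \<open>X\<close>;
      thus \<open>?U\<close> collects the partitions where \<open>a\<close> has company and
      \<open>?V\<close> those where it is alone.\<close>
    let ?f = "\<lambda>(P, X). insert (insert a X) (P - {X})"
    let ?S = "SIGMA P:?Q k. P"
    let ?U = "?f ` ?S" and ?V = "insert {a} ` ?Q l"
    have sub: "\<Union>P = A" if "partition_on A P" for P using that by (simp add: partition_on_def)
    have finP: "finite P" if "partition_on A P" for P
      using finite_elements[OF insert.hyps(1) that] .
    have finQ: "finite (?Q k)" for k
      by (rule finite_subset[OF _ finitely_many_partition_on[OF insert.hyps(1)]]) auto
    have decomp: "{P. partition_on (insert a A) P \<and> card P = k} = ?U \<union> ?V"
    proof (intro equalityI subsetI)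
      fix P assume "P \<in> {P. partition_on (insert a A) P \<and> card P = k}"
      hence P: "partition_on (insert a A) P" "card P = k" by auto
      have fin: "finite P" using finite_elements[OF _ P(1)] insert.hyps by simp
      obtain Y where Y: "Y \<in> P" "a \<in> Y" using P by (auto simp: partition_on_def)
      have other: "a \<notin> Z" "Z \<inter> Y = {}" if "Z \<in> P - {Y}" for Z
        using that Y P by (auto simp: partition_on_def disjoint_def)
      have YY: "insert Y (P - {Y}) = P" using Y by auto
      have dis: "disjnt Y (\<Union>(P - {Y}))" using other by (auto simp: disjnt_def)
      have rest: "partition_on (insert a A - Y) (P - {Y})" "Y \<subseteq> insert a A"
        using P(1) partition_on_insert[OF dis, of "insert a A"] YY by auto
      show "P \<in> ?U \<union> ?V"
      proof (cases "Y = {a}")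
        case True
        have "partition_on A (P - {Y})" using rest True insert.hyps by (simp add: insert_Diff_if)
        moreover have "card (P - {Y}) = l" using P Y Suc fin by simp
        ultimately have "P - {Y} \<in> ?Q l" by simp
        moreover have "P = insert {a} (P - {Y})" using YY True by simp
        ultimately show ?thesis by (intro UnI2 image_eqI)
      next
        case False
        let ?X = "Y - {a}"
        have X: "?X \<noteq> {}" using False Y by auto
        \<comment> \<open>Otherwise removing \<open>a\<close> from its block would merge two members
          of the set and lower the number of blocks.\<close>
        have ne: "?X \<notin> P - {Y}" using other(2) X by (metis Diff_subset Int_absorb2)
        have "disjnt ?X (\<Union>(P - {Y}))" using dis by (auto simp: disjnt_def)
        moreover have "insert a A - Y = A - ?X" using Y insert.hyps by auto
        ultimately have "partition_on A (insert ?X (P - {Y}))"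
          using rest X by (subst partition_on_insert) auto
        moreover have "card (insert ?X (P - {Y})) = k" using ne fin P Y Suc by simp
        ultimately have "(insert ?X (P - {Y}), ?X) \<in> ?S" by simp
        moreover have "insert a ?X = Y" using Y by auto
        hence "P = ?f (insert ?X (P - {Y}), ?X)"
          using ne YY by simp
        ultimately show ?thesis by (intro UnI1 image_eqI)
      qed
    next
      fix P assume "P \<in> ?U \<union> ?V"
      thus "P \<in> {P. partition_on (insert a A) P \<and> card P = k}"
      proof
        assume "P \<in> ?V"
        then obtain Q where Q: "P = insert {a} Q" "partition_on A Q" "card Q = l" by auto
        have "a \<notin> \<Union>Q" using sub[OF Q(2)] insert.hyps by simp
        hence "disjnt {a} (\<Union>Q)" "{a} \<notin> Q" by (auto simp: disjnt_def)
        thus ?thesis using Q insert.hyps partition_on_insert[of "{a}" Q "insert a A"] finP Suc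
          by (simp add: insert_Diff_if)
      next
        assume "P \<in> ?U"
        then obtain Q X where Q: "P = insert (insert a X) (Q - {X})" "partition_on A Q" "card Q = k" "X \<in> Q"
          by auto
        have na: "a \<notin> \<Union>Q" using sub[OF Q(2)] insert.hyps by simp
        have dis: "disjnt X (\<Union>(Q - {X}))" using Q(2,4) by (auto simp: partition_on_def disjoint_def disjnt_def)
        have "partition_on (A - X) (Q - {X}) \<and> X \<subseteq> A"
          using partition_on_insert[OF dis, of A] Q by (simp add: insert_absorb)
        moreover have "insert a A - insert a X = A - X" using insert.hyps by auto
        moreover have "disjnt (insert a X) (\<Union>(Q - {X}))" using dis na by (auto simp: disjnt_def)
        ultimately have "partition_on (insert a A) P"
          unfolding Q(1) by (subst partition_on_insert) auto
        moreover have "insert a X \<notin> Q - {X}" using na by auto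
        hence "card P = k" using Q finP Suc by simp
        ultimately show ?thesis by simp
      qed
    qed
    have disj: "?U \<inter> ?V = {}"
    proof (rule equals0I)
      fix P assume "P \<in> ?U \<inter> ?V"
      then obtain Q X Q' where Q: "partition_on A Q" "X \<in> Q"
        "P = insert (insert a X) (Q - {X})" "P = insert {a} Q'" by auto
      have "a \<notin> \<Union>Q" using sub[of Q] Q insert.hyps by simp
      moreover have "{a} \<in> insert (insert a X) (Q - {X})" using Q(3,4) by (metis insertI1)
      ultimately have "insert a X = {a}" by blast
      moreover have "X \<noteq> {}" using Q by (auto simp: partition_on_def)
      ultimately have "a \<in> X" by blast
      thus False using \<open>a \<notin> \<Union>Q\<close> Q by blast
    qed
    have injU: "inj_on ?f ?S"
    proof (rule inj_onI; clarify)
      fix P X Q Y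
      assume PQ: "X \<in> P" "Y \<in> Q" "partition_on A P" "partition_on A Q"
        and eq: "insert (insert a X) (P - {X}) = insert (insert a Y) (Q - {Y})"
      have na: "a \<notin> \<Union>P" "a \<notin> \<Union>Q" using sub PQ insert.hyps by auto
      \<comment> \<open>The enlarged block is the only member of the result that contains
        \<open>a\<close>, so it can be read off; removing \<open>a\<close> gives back the chosen
        block.\<close>
      have "insert a X = insert a Y"
        using eq na by (metis Diff_iff UnionI insert_iff)
      hence XY: "X = Y" using na PQ by (metis UnionI insert_ident)
      have "P - {X} = Q - {Y}" using eq na XY
        by (metis Diff_iff UnionI insertI1 insert_ident)
      thus "P = Q \<and> X = Y" using XY PQ by blast
    qed
    have injV: "inj_on (insert {a}) (?Q l)"
    proof (rule inj_onI)
      fix P Q assume PQ: "P \<in> ?Q l" "Q \<in> ?Q l" and eq: "insert {a} P = insert {a} Q"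
      have "{a} \<notin> P" "{a} \<notin> Q" using sub PQ insert.hyps by auto
      thus "P = Q" using eq by (metis insert_ident)
    qed
    have finS: "finite ?S" using finQ finP by auto
    have cS: "card ?S = Stirling (card A) k * k"
      using finQ[of k] finP insert.IH[of k] by (simp add: card_SigmaI)
    have "card (?U \<union> ?V) = card ?U + card ?V"
      using finS finQ disj by (intro card_Un_disjoint) auto
    also have "\<dots> = k * Stirling (card A) k + Stirling (card A) l"
      using card_image[OF injU] card_image[OF injV] cS insert.IH[of l] by simp
    finally show ?thesis using decomp Suc insert.hyps by simp
  qed
qed

definition ordered_set_partitions :: "'a set \<Rightarrow> 'a set list set" where
  "ordered_set_partitions A = {C. distinct C \<and> partition_on A (set C)}"

text \<open>Ordered partitions are grouped by the underlying set partition, whose orderings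
  contribute \<open>f m * R m u\<close> for \<open>m\<close> blocks; the set partitions are then
  grouped by \<open>m\<close>.\<close>

lemma sum_ordered_set_partitions:
  fixes u :: "'b :: comm_ring_1" and A :: "nat set"
  assumes "finite A"
  shows "(\<Sum>C\<in>ordered_set_partitions A. f (length C) * u ^ num_fixed_blocks C) = 
         (\<Sum>m=0..card A. of_nat (Stirling (card A) m) * f m * R m u)"
proof -
  let ?P = "{P. partition_on A P}"
  have finP: "finite P" if "partition_on A P" for P using finite_elements[OF assms that] .
  have card_le: "card P \<le> card A" if "partition_on A P" for P
  proof -
    have "Min X \<in> A" if "X \<in> P" for X
    proof -
      have "X \<subseteq> A" "X \<noteq> {}" using that \<open>partition_on A P\<close> by (auto simp: partition_on_def)
      with assms show ?thesis by (meson Min_in finite_subset subsetD)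
    qed
    hence "Min ` P \<subseteq> A" by blast
    with inj_on_Min_partition_on[OF assms that] assms show ?thesis by (metis card_inj_on_le)
  qed
  have "(\<Sum>C\<in>ordered_set_partitions A. f (length C) * u ^ num_fixed_blocks C) =
        (\<Sum>C\<in>(\<Union>P\<in>?P. permutations_of_set P). f (length C) * u ^ num_fixed_blocks C)"
    by (intro sum.cong) (auto simp: ordered_set_partitions_def permutations_of_set_def)
  also have "\<dots> = (\<Sum>P\<in>?P. \<Sum>C\<in>permutations_of_set P. f (length C) * u ^ num_fixed_blocks C)"
    using finitely_many_partition_on[OF assms]
    by (intro sum.UNION_disjoint) (auto dest: permutations_of_setD)
  also have "\<dots> = (\<Sum>P\<in>?P. f (card P) * R (card P) u)"
  proof (intro sum.cong refl)
    fix P assume P: "P \<in> ?P"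
    have "(\<Sum>C\<in>permutations_of_set P. f (length C) * u ^ num_fixed_blocks C) =
          f (card P) * (\<Sum>C\<in>permutations_of_set P. u ^ num_fixed_blocks C)"
      unfolding sum_distrib_left
      by (intro sum.cong) (auto simp: length_finite_permutations_of_set)
    thus "(\<Sum>C\<in>permutations_of_set P. f (length C) * u ^ num_fixed_blocks C) = f (card P) * R (card P) u"
      using sum_power_num_fixed_blocks[of P u] P finP inj_on_Min_partition_on[OF assms] by simp
  qed
  also have "\<dots> = (\<Sum>m=0..card A. \<Sum>P | P \<in> ?P \<and> card P = m. f (card P) * R (card P) u)"
    using finitely_many_partition_on[OF assms] card_le
    by (intro sum.group[symmetric]) auto
  also have "\<dots> = (\<Sum>m=0..card A. of_nat (Stirling (card A) m) * f m * R m u)"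
    by (intro sum.cong refl) (simp add: card_partition_on_Stirling[OF assms] mult.assoc)
  finally show ?thesis .
qed


subsection \<open>Unit interval parking functions\<close>

text \<open>This replaces the recursion by a condition that can be checked car by car: car
  \<open>i\<close> sees \<open>occ\<close> and the spots of the earlier cars, and being the least
  free spot means that all admissible smaller spots are taken.\<close>

lemma park_eq_Some_iff:
  "park n occ as = Some ss \<longleftrightarrow> length ss = length as \<and>
     (\<forall>i<length as. ss ! i \<in> {1..n} \<and> as ! i \<le> ss ! i \<and> ss ! i \<notin> occ \<union> set (take i ss) \<and>
        (\<forall>p\<in>{1..n}. as ! i \<le> p \<longrightarrow> p < ss ! i \<longrightarrow> p \<in> occ \<union> set (take i ss)))"
proof (induction as arbitrary: occ ss)
  case (Cons a as)
  show ?case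
  proof (cases ss)
    case Nil
    thus ?thesis by (auto simp: Let_def)
  next
    case (Cons s ss')
    define free where "free = {s \<in> {1..n}. a \<le> s \<and> s \<notin> occ}"
    have fin: "finite free" by (simp add: free_def)
    have "park n occ (a # as) = Some ss \<longleftrightarrow>
          (free \<noteq> {} \<and> Min free = s) \<and> park n (insert s occ) as = Some ss'"
      unfolding Cons park.simps Let_def free_def[symmetric] by auto
    also have "free \<noteq> {} \<and> Min free = s \<longleftrightarrow> s \<in> free \<and> (\<forall>p\<in>free. s \<le> p)"
      using Min_eq_iff[OF fin, of s] by auto
    also have "\<dots> \<longleftrightarrow> s \<in> {1..n} \<and> a \<le> s \<and> s \<notin> occ \<and>
                    (\<forall>p\<in>{1..n}. a \<le> p \<longrightarrow> p < s \<longrightarrow> p \<in> occ)"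
      unfolding free_def by (auto simp: not_less[symmetric])
    \<comment> \<open>Index 0 is split off; for later cars the spot \<open>s\<close> moves from
      \<open>insert s occ\<close> into the prefix \<open>take i ss\<close>.\<close>
    finally show ?thesis
      unfolding Cons.IH unfolding Cons by (simp add: All_less_Suc2) blast
  qed
qed auto

text \<open>
  \<open>s i\<close> is the spot of car \<open>i\<close>, and \<open>L\<close> is the set of spots whose car parks exactly where it
  prefers to. A car parked one spot further must have found its preferred spot taken by an
  earlier car \<open>c\<close>; this is the last assumption. In the locale, \<open>lower\<close> maps a spot to the
  preference of its car, and \<open>\<nu>\<close> enumerates \<open>L\<close> from index 0, followed by the sentinel \<open>n + 1\<close>.
\<close>

locale unit_interval_data =
  fixes n :: nat and s :: "nat \<Rightarrow> nat" and L :: "nat set"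
  assumes bij: "bij_betw s {1..n} {1..n}"
    and L: "L \<subseteq> {1..n}"
    and unlucky: "\<And>i. i \<in> {1..n} \<Longrightarrow> s i \<notin> L \<Longrightarrow> \<exists>c\<in>{1..<i}. Suc (s c) = s i"
begin

definition lower :: "nat \<Rightarrow> nat" where
  "lower p = (if p \<in> L then p else p - 1)"

definition prefs :: "nat list" where
  "prefs = map (\<lambda>i. lower (s i)) [1..<Suc n]"

definition \<nu> :: "nat \<Rightarrow> nat" where
  "\<nu> j = (sorted_list_of_set L @ [Suc n]) ! j"

lemma s_in: "i \<in> {1..n} \<Longrightarrow> s i \<in> {1..n}"
  using bij by (auto dest: bij_betwE)

lemma s_surj:
  assumes "p \<in> {1..n}"
  obtains i where "i \<in> {1..n}" "p = s i"
  using assms bij that by (metis bij_betw_imp_surj_on imageE)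

lemma s_inj: "i \<in> {1..n} \<Longrightarrow> k \<in> {1..n} \<Longrightarrow> s i = s k \<longleftrightarrow> i = k"
  using bij_betw_imp_inj_on[OF bij] by (rule inj_on_eq_iff)

lemma finite_L: "finite L"
  using L finite_subset by blast

text \<open>The car at spot 1 has no left neighbour that could have displaced it. Hence
  \<open>lower\<close> never yields the spot 0.\<close>

lemma one_in_L: "n > 0 \<Longrightarrow> 1 \<in> L"
proof (rule ccontr)
  assume "n > 0" "1 \<notin> L"
  then obtain i where i: "i \<in> {1..n}" "1 = s i" using s_surj[of 1] by auto
  with \<open>1 \<notin> L\<close> obtain c where "c \<in> {1..<i}" "Suc (s c) = 1" using unlucky[of i] by auto
  thus False using s_in[of c] i by auto
qed

lemma lower_in:
  assumes "p \<in> {1..n}"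
  shows "lower p \<in> {1..n}"
proof (cases "p \<in> L")
  case False
  hence "p \<noteq> 1" using one_in_L assms by auto
  thus ?thesis using False assms by (auto simp: lower_def)
qed (use assms in \<open>simp add: lower_def\<close>)

lemma length_prefs [simp]: "length prefs = n"
  by (simp add: prefs_def)

lemma nth_prefs: "i < n \<Longrightarrow> prefs ! i = lower (s (Suc i))"
  by (simp add: prefs_def del: upt_Suc)

lemma nth_prefs': "i \<in> {1..n} \<Longrightarrow> prefs ! (i - 1) = lower (s i)"
  using nth_prefs[of "i - 1"] by auto

text \<open>A car with spot in \<open>L\<close> gets its preference at once. Any other car skips
  only the spot to its left, which \<open>unlucky\<close> says was taken earlier.\<close>

lemma park_prefs: "park n {} prefs = Some (map s [1..<Suc n])"
  unfolding park_eq_Some_iff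
proof (intro conjI allI impI ballI)
  fix i assume "i < length prefs"
  hence i: "Suc i \<in> {1..n}" by simp
  have nth: "map s [1..<Suc n] ! i = s (Suc i)"
    using i by (simp del: upt_Suc)
  have take: "set (take i (map s [1..<Suc n])) = s ` {1..i}"
    using i by (simp add: take_map take_upt atLeastLessThanSuc_atLeastAtMost del: upt_Suc)
  show "map s [1..<Suc n] ! i \<in> {1..n}" using s_in[OF i] nth by simp
  show "prefs ! i \<le> map s [1..<Suc n] ! i"
    using i nth by (simp add: nth_prefs lower_def)
  have "s (Suc i) \<notin> s ` {1..i}"
  proof
    assume "s (Suc i) \<in> s ` {1..i}"
    then obtain c where c: "c \<in> {1..i}" "s c = s (Suc i)" by auto
    hence "c = Suc i" using s_inj[of c "Suc i"] i by auto
    thus False using c by simp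
  qed
  thus "map s [1..<Suc n] ! i \<notin> {} \<union> set (take i (map s [1..<Suc n]))"
    using nth take by simp
  fix p assume p: "p \<in> {1..n}" "prefs ! i \<le> p" "p < map s [1..<Suc n] ! i"
  hence "lower (s (Suc i)) \<le> p" "p < s (Suc i)" using i nth by (auto simp: nth_prefs)
  hence "s (Suc i) \<notin> L" "Suc p = s (Suc i)" by (auto simp: lower_def split: if_splits)
  then obtain c where "c \<in> {1..<Suc i}" "Suc (s c) = Suc p" using unlucky[OF i] by auto
  hence "p \<in> s ` {1..i}" by auto
  thus "p \<in> {} \<union> set (take i (map s [1..<Suc n]))" using take by simp
qed simp

lemma spots_prefs: "spots prefs = map s [1..<Suc n]"
  by (simp only: spots_def length_prefs park_prefs option.sel)

lemma prefs_in_UPF: "prefs \<in> UPF n"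
proof -
  have "set prefs \<subseteq> {1..n}"
    using lower_in s_in by (auto simp: prefs_def simp del: upt_Suc)
  moreover have "spots prefs ! i - prefs ! i \<in> {0, 1}" if "i < n" for i
    using that by (auto simp: spots_prefs nth_prefs lower_def simp del: upt_Suc)
  ultimately show ?thesis
    by (simp add: UPF_def parking_function_def park_prefs del: upt_Suc)
qed

text \<open>Summed over spots instead of cars, each spot outside \<open>L\<close> contributes 1 and
  each spot in \<open>L\<close> contributes 0.\<close>

lemma displacement_prefs: "displacement prefs = n - card L"
proof -
  have "displacement prefs = (\<Sum>i<n. s (Suc i) - lower (s (Suc i)))"
    by (simp add: displacement_def spots_prefs nth_prefs del: upt_Suc)
  also have "\<dots> = (\<Sum>i\<in>{1..n}. s i - lower (s i))"
    by (rule sum.reindex_bij_witness[of _ "\<lambda>i. i - 1" Suc]) auto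
  also have "\<dots> = (\<Sum>p\<in>{1..n}. p - lower p)"
    by (rule sum.reindex_bij_betw[OF bij])
  also have "\<dots> = (\<Sum>p\<in>{1..n}. if p \<in> L then 0 else 1)"
    by (intro sum.cong) (auto simp: lower_def)
  also have "\<dots> = card ({1..n} - L)"
    by (simp add: sum.If_cases Diff_eq)
  also have "\<dots> = n - card L"
    using L finite_L by (simp add: card_Diff_subset)
  finally show ?thesis .
qed

text \<open>Since \<open>lower\<close> is monotone, listing the preferences by spot instead of by
  car sorts them.\<close>

lemma sort_prefs: "sort prefs = map lower [1..<Suc n]"
proof (rule properties_for_sort)
  have "mset prefs = image_mset lower (image_mset s (mset_set {1..n}))"
    by (simp add: prefs_def multiset.map_comp o_def atLeastLessThanSuc_atLeastAtMost del: upt_Suc)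
  also have "image_mset s (mset_set {1..n}) = mset_set {1..n}"
    using bij by (simp add: image_mset_mset_set bij_betw_def)
  finally show "mset (map lower [1..<Suc n]) = mset prefs"
    by (simp add: atLeastLessThanSuc_atLeastAtMost del: upt_Suc)
  have "lower p \<le> lower q" if "p \<le> q" for p q
    using that by (cases "p = q") (auto simp: lower_def)
  thus "sorted (map lower [1..<Suc n])"
    by (simp add: sorted_map sorted_wrt_upt sorted_wrt_mono_rel[OF _ sorted_upt] del: upt_Suc)
qed

lemma block_starts_prefs: "block_starts prefs = sorted_list_of_set L"
proof -
  have "block_starts prefs = filter (\<lambda>i. i \<in> L) [1..<Suc n]"
    unfolding block_starts_def sort_prefs length_prefs Suc_eq_plus1[symmetric]
    by (intro filter_cong refl) (auto simp: lower_def split: if_splits simp del: upt_Suc)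
  also have "\<dots> = sorted_list_of_set L"
    using L finite_L by (intro sorted_distinct_set_unique) (auto simp: sorted_wrt_filter simp del: upt_Suc)
  finally show ?thesis .
qed

text \<open>\<open>lower\<close> shifts a spot by at most one, and not at all on \<open>L\<close>,
  so it crosses no block boundary. Preferences can therefore be replaced by spots in the description
  of the blocks.\<close>

lemma lower_less_iff:
  assumes "p \<in> {1..n}" "q \<in> insert (Suc n) L"
  shows "lower p < q \<longleftrightarrow> p < q"
proof (cases "p = q")
  case True
  hence "p \<in> L" using assms by auto
  thus ?thesis using True by (simp add: lower_def)
qed (use assms in \<open>auto simp: lower_def\<close>)

section \<open>Block boundaries, and blocks as preimages of intervals of spots\<close>

lemma nu_less: "j < k \<Longrightarrow> k \<le> card L \<Longrightarrow> \<nu> j < \<nu> k"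
proof -
  have "sorted_wrt (<) (sorted_list_of_set L @ [Suc n])"
    using L finite_L by (auto simp: sorted_wrt_append)
  thus "j < k \<Longrightarrow> k \<le> card L \<Longrightarrow> \<nu> j < \<nu> k"
    unfolding \<nu>_def by (rule sorted_wrt_nth_less) auto
qed

lemma nu_le: "j \<le> k \<Longrightarrow> k \<le> card L \<Longrightarrow> \<nu> j \<le> \<nu> k"
  using nu_less[of j k] by (cases "j = k") auto

lemma nu_card_L: "\<nu> (card L) = Suc n"
  by (simp add: \<nu>_def nth_append)

lemma nu_image: "\<nu> ` {..<card L} = L"
proof -
  have "L = set (sorted_list_of_set L)" using finite_L by simp
  also have "\<dots> = (\<lambda>j. sorted_list_of_set L ! j) ` {..<card L}"
    by (auto simp: set_conv_nth)
  also have "\<dots> = \<nu> ` {..<card L}"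
    by (intro image_cong) (auto simp: \<nu>_def nth_append)
  finally show ?thesis ..
qed

lemma nu_in: "j \<le> card L \<Longrightarrow> \<nu> j \<in> insert (Suc n) L"
  using nu_image nu_card_L by (cases "j = card L") auto

lemma nu_0: "\<nu> 0 = 1"
proof (cases "n = 0")
  \<comment> \<open>On the empty street \<open>L\<close> is empty, and the value is the
    sentinel.\<close>
  case True
  thus ?thesis using L nu_card_L by simp
next
  case False
  then obtain j where j: "j < card L" "\<nu> j = 1" using one_in_L nu_image by (metis imageE lessThan_iff neq0_conv)
  have "\<nu> 0 \<in> L" using j nu_image by auto
  hence "\<nu> 0 \<ge> 1" using L by auto
  thus ?thesis using j nu_le[of 0 j] by simp
qed

lemma blocks_prefs: "blocks prefs = map (\<lambda>j. {i\<in>{1..n}. \<nu> j \<le> s i \<and> s i < \<nu> (Suc j)}) [0..<card L]"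
proof -
  have "blocks prefs = map (\<lambda>j. {i \<in> {1..n}. \<nu> j \<le> prefs ! (i - 1) \<and> prefs ! (i - 1) < \<nu> (Suc j)}) [0..<card L]"
    by (simp add: blocks_def block_starts_prefs \<nu>_def Let_def)
  also have "\<dots> = map (\<lambda>j. {i\<in>{1..n}. \<nu> j \<le> s i \<and> s i < \<nu> (Suc j)}) [0..<card L]"
  proof (intro map_cong refl Collect_cong conj_cong)
    fix j i assume "j \<in> set [0..<card L]" and i: "i \<in> {1..n}"
    hence j: "\<nu> j \<in> insert (Suc n) L" "\<nu> (Suc j) \<in> insert (Suc n) L" using nu_in by auto
    have "prefs ! (i - 1) = lower (s i)" using i by (rule nth_prefs')
    thus "\<nu> j \<le> prefs ! (i - 1) \<longleftrightarrow> \<nu> j \<le> s i" "prefs ! (i - 1) < \<nu> (Suc j) \<longleftrightarrow> s i < \<nu> (Suc j)"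
      using lower_less_iff[OF s_in[OF i] j(1)] lower_less_iff[OF s_in[OF i] j(2)] by auto
  qed
  finally show ?thesis .
qed

lemma length_blocks_prefs [simp]: "length (blocks prefs) = card L"
  by (simp add: blocks_prefs)

lemma nth_blocks_prefs:
  "j < card L \<Longrightarrow> blocks prefs ! j = {i\<in>{1..n}. \<nu> j \<le> s i \<and> s i < \<nu> (Suc j)}"
  by (simp add: blocks_prefs)

lemma s_image_block:
  assumes "j < card L"
  shows "s ` (blocks prefs ! j) = {\<nu> j..<\<nu> (Suc j)}"
proof (intro equalityI subsetI)
  fix p assume p: "p \<in> {\<nu> j..<\<nu> (Suc j)}"
  have "1 \<le> \<nu> j" "\<nu> (Suc j) \<le> Suc n"
    using nu_le[of 0 j] nu_le[of "Suc j" "card L"] assms nu_0 nu_card_L by auto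
  with p have "p \<in> {1..n}" by auto
  then obtain i where "i \<in> {1..n}" "p = s i" by (rule s_surj)
  thus "p \<in> s ` (blocks prefs ! j)" using p assms by (auto simp: nth_blocks_prefs)
qed (use assms in \<open>auto simp: nth_blocks_prefs\<close>)

lemma block_subset: "j < card L \<Longrightarrow> blocks prefs ! j \<subseteq> {1..n}"
  by (auto simp: nth_blocks_prefs)

lemma card_s_image: "A \<subseteq> {1..n} \<Longrightarrow> card (s ` A) = card A"
  using bij by (metis bij_betw_def card_image inj_on_subset)

lemma card_block: "j < card L \<Longrightarrow> card (blocks prefs ! j) = \<nu> (Suc j) - \<nu> j"
  using card_s_image[OF block_subset, of j] by (simp add: s_image_block)

text \<open>Block sizes are the gaps between consecutive boundaries, so the sum telescopes. This
  recovers the boundaries from the blocks.\<close>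

lemma nu_eq_sum: "j \<le> card L \<Longrightarrow> \<nu> j = Suc (\<Sum>l<j. card (blocks prefs ! l))"
proof (induction j)
  case (Suc j)
  thus ?case using nu_less[of j "Suc j"] by (simp add: card_block)
qed (simp add: nu_0)

lemma block_unique:
  assumes "j < card L" "k < card L" "i \<in> blocks prefs ! j" "i \<in> blocks prefs ! k"
  shows "j = k"
proof (rule ccontr)
  assume "j \<noteq> k"
  hence "Suc j \<le> k \<or> Suc k \<le> j" by auto
  thus False
    using nu_le[of "Suc j" k] nu_le[of "Suc k" j] assms by (auto simp: nth_blocks_prefs)
qed

lemma blocks_in_ordered_set_partitions: "blocks prefs \<in> ordered_set_partitions {1..n}"
proof -
  have nonempty: "blocks prefs ! j \<noteq> {}" if "j < card L" for j
    using s_image_block[OF that] nu_less[of j "Suc j"] that by auto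
  have "distinct (blocks prefs)"
    unfolding distinct_conv_nth using nonempty block_unique by (metis ex_in_conv length_blocks_prefs)
  moreover have "partition_on {1..n} (set (blocks prefs))"
  proof (rule partition_onI)
    show "\<Union>(set (blocks prefs)) = {1..n}"
    proof (intro equalityI subsetI)
      fix i assume i: "i \<in> {1..n}"
      \<comment> \<open>The first boundary beyond the spot of car \<open>i\<close> closes its block,
        so the block has index \<open>j - 1\<close>.\<close>
      define j where "j = (LEAST j. s i < \<nu> j)"
      have below: "s i < \<nu> (card L)" using s_in[OF i] nu_card_L by simp
      have j: "s i < \<nu> j" "j \<le> card L" 
        using LeastI[of "\<lambda>j. s i < \<nu> j", OF below] Least_le[of "\<lambda>j. s i < \<nu> j", OF below]
        by (simp_all add: j_def)
      have "j \<noteq> 0" using j s_in[OF i] nu_0 by (cases "j = 0") auto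
      then obtain k where k: "j = Suc k" by (cases j) auto
      hence "\<nu> k \<le> s i" using not_less_Least[of k "\<lambda>j. s i < \<nu> j"] by (simp add: j_def)
      hence "i \<in> blocks prefs ! k" "k < card L" using i j k by (auto simp: nth_blocks_prefs)
      thus "i \<in> \<Union>(set (blocks prefs))" by (metis UnionI length_blocks_prefs nth_mem)
    qed (auto simp: in_set_conv_nth nth_blocks_prefs)
    show "disjnt X Y" if "X \<in> set (blocks prefs)" "Y \<in> set (blocks prefs)" "X \<noteq> Y" for X Y
      using that block_unique by (fastforce simp: in_set_conv_nth disjnt_iff)
    show "{} \<notin> set (blocks prefs)" using nonempty by (auto simp: in_set_conv_nth)
  qed
  ultimately show ?thesis by (simp add: ordered_set_partitions_def)
qed

text \<open>Walking left from \<open>s i\<close>, no spot before \<open>s c\<close> is reached lies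
  in \<open>L\<close>, so each left neighbour arrived earlier than the car it displaced.\<close>

lemma less_if_same_run:
  assumes "c \<in> {1..n}" "i \<in> {1..n}" "s c < s i" "{s c<..s i} \<inter> L = {}"
  shows "c < i"
  using assms(2-)
proof (induction "s i" arbitrary: i rule: less_induct)
  case less
  from less.prems have "s i \<notin> L" by auto
  then obtain c' where c': "c' \<in> {1..<i}" "Suc (s c') = s i" using unlucky less.prems(1) by blast
  show ?case
  proof (cases "s c' = s c")
    case True
    hence "c' = c" using s_inj[of c' c] assms(1) c' less.prems by auto
    thus ?thesis using c' by simp
  next
    case False
    moreover have "{s c<..s c'} \<subseteq> {s c<..s i}" using c' by auto
    ultimately have "c < c'" using c' less.prems by (intro less.hyps) auto
    thus ?thesis using c' by simp
  qed
qed

lemma not_in_L_if_inside_block: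
  assumes "j < card L" "\<nu> j < p" "p < \<nu> (Suc j)"
  shows "p \<notin> L"
proof
  assume "p \<in> L"
  then obtain k where "k < card L" "p = \<nu> k" using nu_image by blast
  thus False using assms nu_le[of k j] nu_le[of "Suc j" k] by (cases "k \<le> j") auto
qed

text \<open>Within a block the spots increase with the car numbers and fill an interval from
  \<open>\<nu> j\<close> on, so the offset of a car is its rank in the block, counted from
  0.\<close>

lemma s_eq:
  assumes "j < card L" "i \<in> blocks prefs ! j"
  shows "s i = \<nu> j + card {c\<in>blocks prefs ! j. c < i}"
proof -
  have i: "i \<in> {1..n}" "\<nu> j \<le> s i" "s i < \<nu> (Suc j)" using assms by (auto simp: nth_blocks_prefs)
  have less: "c < k" if "c \<in> blocks prefs ! j" "k \<in> blocks prefs ! j" "s c < s k" for c k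
  proof (rule less_if_same_run)
    show "{s c<..s k} \<inter> L = {}"
      using not_in_L_if_inside_block[OF assms(1)] that assms(1) by (fastforce simp: nth_blocks_prefs)
  qed (use that assms in \<open>auto simp: nth_blocks_prefs\<close>)
  have "s ` {c\<in>blocks prefs ! j. c < i} = {\<nu> j..<s i}"
  proof (intro equalityI subsetI)
    fix p assume "p \<in> s ` {c\<in>blocks prefs ! j. c < i}"
    then obtain c where c: "c \<in> blocks prefs ! j" "c < i" "p = s c" by auto
    have "\<not> s i < s c" using less[of i c] c assms by auto
    moreover have "s c \<noteq> s i" using s_inj[of c i] c i block_subset[OF assms(1)] by auto
    ultimately show "p \<in> {\<nu> j..<s i}" using c assms by (auto simp: nth_blocks_prefs)
  next
    fix p assume p: "p \<in> {\<nu> j..<s i}"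
    hence "p \<in> s ` (blocks prefs ! j)" using s_image_block[OF assms(1)] i by auto
    then obtain c where c: "c \<in> blocks prefs ! j" "p = s c" by auto
    thus "p \<in> s ` {c\<in>blocks prefs ! j. c < i}" using less[of c i] assms p by auto
  qed
  hence "card {c\<in>blocks prefs ! j. c < i} = s i - \<nu> j"
    using card_s_image[of "{c\<in>blocks prefs ! j. c < i}"] block_subset[OF assms(1)]
    by (simp add: subset_iff)
  thus ?thesis using i by simp
qed

text \<open>
  The right-hand side depends only on the block sequence, so the blocks determine the tuple.
  The subtraction is meant to truncate: the first two cars of a block share a preference.
\<close>

lemma nth_prefs_eq:
  assumes "j < length (blocks prefs)" "i \<in> blocks prefs ! j"
  shows "prefs ! (i - 1) =
    Suc (\<Sum>l<j. card (blocks prefs ! l)) + (card {c\<in>blocks prefs ! j. c < i} - 1)"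
proof -
  have j: "j < card L" using assms by simp
  have i: "i \<in> {1..n}" "s i < \<nu> (Suc j)" using assms by (auto simp: nth_blocks_prefs)
  define k where "k = card {c\<in>blocks prefs ! j. c < i}"
  have s_i: "s i = \<nu> j + k" using s_eq[OF j assms(2)] by (simp add: k_def)
  have "lower (s i) = \<nu> j + (k - 1)"
  proof (cases "k = 0")
    case True
    moreover have "\<nu> j \<in> L" using nu_image j by auto
    ultimately show ?thesis by (simp add: s_i lower_def)
  next
    case False
    hence "s i \<notin> L" using s_i i not_in_L_if_inside_block[OF j] by simp
    thus ?thesis using False s_i by (simp add: lower_def)
  qed
  thus ?thesis using nth_prefs'[OF i(1)] j nu_eq_sum[of j] by (simp add: k_def)
qed

end

text \<open>The data are the parking outcome and the spots of the undisplaced cars. A displaced car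
  moves by exactly one, past a spot that an earlier car has taken.\<close>

lemma UPF_obtain_data:
  assumes "\<alpha> \<in> UPF n"
  obtains s L where "unit_interval_data n s L" "\<alpha> = unit_interval_data.prefs n s L"
proof -
  from assms have len: "length \<alpha> = n" and sub: "set \<alpha> \<subseteq> {1..n}" and "park n {} \<alpha> \<noteq> None"
    and unit: "\<And>i. i < n \<Longrightarrow> spots \<alpha> ! i - \<alpha> ! i \<in> {0, 1}"
    by (auto simp: UPF_def parking_function_def)
  define ss where "ss = spots \<alpha>"
  have "park n {} \<alpha> = Some ss" using \<open>park n {} \<alpha> \<noteq> None\<close> len by (auto simp: ss_def spots_def)
  hence ss: "length ss = n" "\<And>i. i < n \<Longrightarrow> ss ! i \<in> {1..n}" "\<And>i. i < n \<Longrightarrow> \<alpha> ! i \<le> ss ! i"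
     "\<And>i. i < n \<Longrightarrow> ss ! i \<notin> set (take i ss)"
     "\<And>i p. i < n \<Longrightarrow> p \<in> {1..n} \<Longrightarrow> \<alpha> ! i \<le> p \<Longrightarrow> p < ss ! i \<Longrightarrow> p \<in> set (take i ss)"
    unfolding park_eq_Some_iff using len by auto
  define s where "s = (\<lambda>i. ss ! (i - 1))"
  define L where "L = {s i | i. i \<in> {1..n} \<and> \<alpha> ! (i - 1) = s i}"
  have ne: "ss ! i \<noteq> ss ! k" if "i < k" "k < n" for i k
    using ss(4)[of k] that ss(1) by (auto simp: in_set_conv_nth)
  have s_ne: "s i \<noteq> s k" if "i < k" "i \<in> {1..n}" "k \<in> {1..n}" for i k
    using ne[of "i - 1" "k - 1"] that by (auto simp: s_def)
  have inj: "inj_on s {1..n}"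
    by (intro linorder_inj_onI) (use s_ne in auto)
  have sub_s: "s ` {1..n} \<subseteq> {1..n}" using ss(2) by (fastforce simp: s_def)
  have "bij_betw s {1..n} {1..n}"
    using inj sub_s by (simp add: bij_betw_def endo_inj_surj)
  moreover have "\<exists>c\<in>{1..<i}. Suc (s c) = s i" if i: "i \<in> {1..n}" "s i \<notin> L" for i
  proof -
    let ?a = "\<alpha> ! (i - 1)"
    have "?a \<noteq> s i" using i by (auto simp: L_def)
    moreover from i have "i - 1 < n" by auto
    ultimately have "?a \<noteq> s i" "?a \<le> s i" "s i - ?a \<in> {0, 1}"
      using unit[of "i - 1"] ss(3)[of "i - 1"] by (simp_all add: ss_def s_def)
    hence Suc_a: "Suc ?a = s i" by auto
    \<comment> \<open>The condition on skipped spots concerns only spots of the street, so the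
      preference is first shown to be one.\<close>
    have a: "?a \<in> {1..n}" using sub nth_mem[of "i - 1" \<alpha>] \<open>i - 1 < n\<close> len by blast
    hence "?a \<in> set (take (i - 1) ss)"
      using Suc_a \<open>i - 1 < n\<close> by (intro ss(5)) (auto simp: s_def)
    then obtain k where "k < i - 1" "?a = ss ! k" using \<open>i - 1 < n\<close> ss(1) by (auto simp: in_set_conv_nth)
    hence "Suc k \<in> {1..<i}" "s (Suc k) = ?a" by (auto simp: s_def)
    thus ?thesis using Suc_a by metis
  qed
  ultimately have data: "unit_interval_data n s L"
    using sub_s by unfold_locales (auto simp: L_def)
  interpret unit_interval_data n s L by (rule data)
  have "\<alpha> = prefs"
  proof (rule nth_equalityI)
    fix i assume i: "i < length \<alpha>"
    show "\<alpha> ! i = prefs ! i"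
    proof (cases "s (Suc i) \<in> L")
      case True
      then obtain k where k: "k \<in> {1..n}" "\<alpha> ! (k - 1) = s k" "s (Suc i) = s k" by (auto simp: L_def)
      moreover have "Suc i \<in> {1..n}" using i len by simp
      ultimately have "k = Suc i" using s_inj by metis
      with k(2) have "\<alpha> ! i = s (Suc i)" by simp
      thus ?thesis using i len True by (simp add: nth_prefs lower_def)
    next
      case False
      have "s (Suc i) \<in> L" if "\<alpha> ! i = s (Suc i)"
        unfolding L_def using that i len by (intro CollectI exI[of _ "Suc i"]) simp
      with False have "\<alpha> ! i \<noteq> s (Suc i)" by blast
      moreover have "\<alpha> ! i \<le> s (Suc i)" "s (Suc i) - \<alpha> ! i \<in> {0, 1}"
        using unit[of i] ss(3)[of i] i len by (simp_all add: ss_def s_def)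
      moreover have "prefs ! i = s (Suc i) - 1"
        using False i len by (simp add: nth_prefs lower_def)
      ultimately show ?thesis by auto
    qed
  qed (simp add: len)
  with data show ?thesis by (rule that)
qed

text \<open>\<open>nth_prefs_eq\<close> gives every entry in terms of the block list alone, so equal
  block lists force equal entries.\<close>

lemma inj_on_blocks_UPF: "inj_on blocks (UPF n)"
proof (rule inj_onI)
  fix \<alpha> \<beta> assume "\<alpha> \<in> UPF n" "\<beta> \<in> UPF n" and eq: "blocks \<alpha> = blocks \<beta>"
  obtain s L where A: "unit_interval_data n s L" "\<alpha> = unit_interval_data.prefs n s L"
    using \<open>\<alpha> \<in> UPF n\<close> by (rule UPF_obtain_data)
  obtain s' L' where B: "unit_interval_data n s' L'" "\<beta> = unit_interval_data.prefs n s' L'"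
    using \<open>\<beta> \<in> UPF n\<close> by (rule UPF_obtain_data)
  interpret A: unit_interval_data n s L by (rule A)
  interpret B: unit_interval_data n s' L' by (rule B)
  show "\<alpha> = \<beta>"
  proof (rule nth_equalityI)
    fix i assume "i < length \<alpha>"
    hence "Suc i \<in> {1..n}" using A(2) by simp
    hence "Suc i \<in> \<Union>(set (blocks \<alpha>))"
      using A.blocks_in_ordered_set_partitions A(2)
      by (simp add: ordered_set_partitions_def partition_on_def)
    then obtain j where "j < length (blocks \<alpha>)" "Suc i \<in> blocks \<alpha> ! j" by (auto simp: in_set_conv_nth)
    thus "\<alpha> ! i = \<beta> ! i"
      using A.nth_prefs_eq[of j "Suc i"] B.nth_prefs_eq[of j "Suc i"] A(2) B(2) eq by (simp del: A.length_blocks_prefs B.length_blocks_prefs)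
  qed (simp add: A(2) B(2))
qed

text \<open>The preimage lets the cars of each block fill consecutive spots in increasing order,
  block after block; \<open>L\<close> consists of the first spots of the blocks.\<close>

lemma ordered_set_partition_blocks:
  assumes "C \<in> ordered_set_partitions {1..n}"
  shows "\<exists>\<alpha>\<in>UPF n. blocks \<alpha> = C"
proof -
  \<comment> \<open>The choice is forced by \<open>nu_eq_sum\<close>, and that of \<open>s\<close>
    below by \<open>s_eq\<close>.\<close>
  define b where "b j = Suc (\<Sum>l<j. card (C ! l))" for j
  define m where "m = length C"
  have dist: "distinct C" and part: "partition_on {1..n} (set C)"
    using assms by (auto simp: ordered_set_partitions_def)
  have sub: "C ! j \<subseteq> {1..n}" if "j < m" for j
    using part that by (auto simp: partition_on_def m_def)
  have fin: "finite (C ! j)" if "j < m" for j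
    using sub[OF that] finite_subset by blast
  have ne: "C ! j \<noteq> {}" if "j < m" for j
    using part that by (metis m_def nth_mem partition_onD3)
  have uniq: "j = k" if "j < m" "k < m" "i \<in> C ! j" "i \<in> C ! k" for i j k
    using that dist part by (metis disjnt_iff m_def nth_eq_iff_index_eq nth_mem pairwiseD partition_onD2)
  have "\<forall>i\<in>{1..n}. \<exists>j<m. i \<in> C ! j"
    using part by (auto simp: partition_on_def m_def in_set_conv_nth) (metis UnionE atLeastAtMost_iff in_set_conv_nth)
  then obtain idx where idx: "\<And>i. i \<in> {1..n} \<Longrightarrow> idx i < m \<and> i \<in> C ! idx i" by metis
  have idx_eq: "idx i = j" if "j < m" "i \<in> C ! j" for i j
    using uniq[of "idx i" j i] idx[of i] that sub by blast
  define s where "s i = b (idx i) + card {c\<in>C ! idx i. c < i}" for i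
  define L where "L = b ` {..<m}"
  have b_mono: "b j \<le> b k" if "j \<le> k" for j k
    unfolding b_def using that by (auto intro!: sum_mono2)
  have b_Suc: "b (Suc j) = b j + card (C ! j)" for j by (simp add: b_def)
  have b_less_Suc: "b j < b (Suc j)" if "j < m" for j
    using ne[OF that] fin[OF that] by (simp add: b_Suc card_gt_0_iff)
  have b_less: "b j < b k" if "j < k" "k \<le> m" for j k
    using b_less_Suc[of j] b_mono[of "Suc j" k] that by simp
  \<comment> \<open>The sizes of the disjoint blocks add up to \<open>n\<close>, so the last
    boundary is the sentinel.\<close>
  have "(\<Sum>l<m. card (C ! l)) = (\<Sum>X\<in>set C. card X)"
    by (rule sum.reindex_bij_betw) (simp add: bij_betw_nth dist m_def)
  also have "\<dots> = card (\<Union>(set C))"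
    using part finite_subset[of _ "{1..n}"]
    by (intro card_Union_disjoint[symmetric]) (auto simp: partition_on_def)
  finally have b_m: "b m = Suc n" using part by (simp add: b_def partition_on_def)
  have card_less: "card {c\<in>C ! j. c < i} < card {c\<in>C ! j. c < k}" if "j < m" "i \<in> C ! j" "i < k" for i j k
    using that fin by (intro psubset_card_mono) auto
  have s_range: "b (idx i) \<le> s i" "s i < b (Suc (idx i))" if "i \<in> {1..n}" for i
  proof -
    have "card {c\<in>C ! idx i. c < i} < card (C ! idx i)"
      using idx[OF that] fin by (intro psubset_card_mono) auto
    thus "b (idx i) \<le> s i" "s i < b (Suc (idx i))" by (auto simp: s_def b_Suc)
  qed
  have idx_iff: "b j \<le> s i \<and> s i < b (Suc j) \<longleftrightarrow> idx i = j" if "i \<in> {1..n}" "j < m" for i j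
  proof
    assume "b j \<le> s i \<and> s i < b (Suc j)"
    thus "idx i = j" using s_range[OF that(1)] b_mono[of "Suc j" "idx i"] b_mono[of "Suc (idx i)" j]
      by (cases j "idx i" rule: linorder_cases) auto
  qed (use s_range[OF that(1)] in auto)
  have "inj_on s {1..n}"
  proof (rule linorder_inj_onI)
    fix i k assume ik: "i < k" "i \<in> {1..n}" "k \<in> {1..n}"
    show "s i \<noteq> s k"
    proof
      assume eq: "s i = s k"
      hence "idx i = idx k" using idx_iff[of i "idx k"] s_range[of k] idx[of k] ik by auto
      thus False using eq card_less[of "idx i" i k] idx[of i] ik by (simp add: s_def)
    qed
  qed auto
  moreover have "s ` {1..n} \<subseteq> {1..n}"
  proof clarify
    fix i assume i: "i \<in> {1..n}"
    have "1 \<le> b (idx i)" "b (Suc (idx i)) \<le> Suc n"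
      using b_mono[of "Suc (idx i)" m] idx[OF i] b_m by (auto simp: b_def)
    thus "s i \<in> {1..n}" using s_range[OF i] by auto
  qed
  ultimately have "bij_betw s {1..n} {1..n}" by (simp add: bij_betw_def endo_inj_surj)
  moreover have "L \<subseteq> {1..n}"
  proof
    fix p assume "p \<in> L"
    then obtain j where "j < m" "p = b j" by (auto simp: L_def)
    thus "p \<in> {1..n}" using b_less[of j m] b_m by (auto simp: b_def)
  qed
  moreover have "\<exists>c\<in>{1..<i}. Suc (s c) = s i" if i: "i \<in> {1..n}" "s i \<notin> L" for i
  proof -
    define P where "P = {c\<in>C ! idx i. c < i}"
    have "finite P" using fin idx i by (auto simp: P_def)
    \<comment> \<open>The first car of a block parks at a spot of \<open>L\<close>, so
      \<open>i\<close> has a predecessor in its block.\<close>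
    moreover have "s i \<noteq> b (idx i)" using i idx[of i] by (auto simp: L_def)
    hence "P \<noteq> {}" by (auto simp: s_def P_def[symmetric])
    ultimately have c: "Max P \<in> P" "\<And>c. c \<in> P \<Longrightarrow> c \<le> Max P" by auto
    \<comment> \<open>The immediate predecessor has rank one less than \<open>i\<close>, hence parks
      directly to its left.\<close>
    define c where "c = Max P"
    have cP: "c \<in> C ! idx i" "c < i" using c(1) by (auto simp: c_def P_def)
    have "P = insert c {k\<in>C ! idx i. k < c}"
      using c(2) cP by (fastforce simp: P_def c_def order.strict_iff_order)
    hence "card P = Suc (card {k\<in>C ! idx i. k < c})"
      using fin idx i by simp
    moreover have "idx c = idx i" using idx_eq cP idx i by blast
    ultimately have "Suc (s c) = s i" by (simp add: s_def P_def)
    moreover have "c \<in> {1..n}" using sub cP idx i by blast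
    ultimately show ?thesis using cP by auto
  qed
  ultimately have data: "unit_interval_data n s L" by unfold_locales auto
  interpret unit_interval_data n s L by (rule data)
  have sorted_L: "sorted_list_of_set L = map b [0..<m]"
  proof (rule sorted_distinct_set_unique)
    show "distinct (map b [0..<m])"
      using b_less by (auto simp: distinct_map intro!: linorder_inj_onI) (metis less_imp_le_nat less_irrefl)
    show "sorted (map b [0..<m])" using b_mono by (auto simp: sorted_iff_nth_mono)
  qed (auto simp: L_def finite_L)
  have card_L: "card L = m" using arg_cong[OF sorted_L, of length] by simp
  have nu: "\<nu> j = b j" if "j \<le> m" for j
    using that b_m by (auto simp: \<nu>_def sorted_L nth_append)
  have "blocks prefs = C"
  proof (rule nth_equalityI)
    fix j assume "j < length (blocks prefs)"
    hence j: "j < m" using card_L by simp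
    have "blocks prefs ! j = {i\<in>{1..n}. b j \<le> s i \<and> s i < b (Suc j)}"
      using j card_L by (simp add: nth_blocks_prefs nu)
    also have "\<dots> = {i\<in>{1..n}. idx i = j}"
      using idx_iff j by blast
    also have "\<dots> = C ! j"
      using idx idx_eq sub j by blast
    finally show "blocks prefs ! j = C ! j" .
  qed (simp add: card_L m_def)
  thus ?thesis using prefs_in_UPF by blast
qed

lemma bij_betw_blocks: "bij_betw blocks (UPF n) (ordered_set_partitions {1..n})"
proof -
  have "blocks \<alpha> \<in> ordered_set_partitions {1..n}" if "\<alpha> \<in> UPF n" for \<alpha>
    using UPF_obtain_data[OF that] unit_interval_data.blocks_in_ordered_set_partitions by metis
  thus ?thesis using inj_on_blocks_UPF ordered_set_partition_blocks unfolding bij_betw_def by blast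
qed

lemma displacement_UPF: "\<alpha> \<in> UPF n \<Longrightarrow> displacement \<alpha> = n - length (blocks \<alpha>)"
  by (metis UPF_obtain_data unit_interval_data.displacement_prefs unit_interval_data.length_blocks_prefs)

text \<open>Both statistics depend on the blocks only, so the bijection \<open>blocks\<close>
  transports the sum. The ring is arbitrary, which covers polynomial variables as well as single
  values.\<close>

lemma sum_UPF:
  fixes u t :: "'a :: comm_ring_1"
  shows "(\<Sum>\<alpha>\<in>UPF n. u ^ fix_stat \<alpha> * t ^ displacement \<alpha>) =
         (\<Sum>m=0..n. of_nat (Stirling n m) * t ^ (n - m) * R m u)"
proof -
  have "(\<Sum>\<alpha>\<in>UPF n. u ^ fix_stat \<alpha> * t ^ displacement \<alpha>) =
        (\<Sum>\<alpha>\<in>UPF n. t ^ (n - length (blocks \<alpha>)) * u ^ num_fixed_blocks (blocks \<alpha>))"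
    by (intro sum.cong) (auto simp: fix_stat_def displacement_UPF mult.commute)
  also have "\<dots> = (\<Sum>C\<in>ordered_set_partitions {1..n}. t ^ (n - length C) * u ^ num_fixed_blocks C)"
    by (rule sum.reindex_bij_betw[OF bij_betw_blocks])
  also have "\<dots> = (\<Sum>m=0..n. of_nat (Stirling n m) * t ^ (n - m) * R m u)"
    using sum_ordered_set_partitions[of "{1..n}" "\<lambda>k. t ^ (n - k)" u] by simp
  finally show ?thesis .
qed


subsection \<open>Generating functions\<close>

text \<open>With \<open>G\<close> for the series \<open>e^x - 1\<close>, the derivative of
  \<open>G ^ m\<close> is \<open>m * (G ^ m + G ^ (m - 1))\<close>; comparing coefficients gives the
  Stirling recurrence.\<close>

lemma fps_exp_minus_1_power_nth:
  "(fps_exp 1 - 1 :: 'a :: field_char_0 fps) ^ m $ n = fact m * of_nat (Stirling n m) / fact n"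
proof (induction n arbitrary: m)
  case 0
  thus ?case by (cases m) auto
next
  case (Suc n)
  show ?case
  proof (cases m)
    case (Suc k)
    let ?G = "fps_exp 1 - 1 :: 'a fps"
    have "fps_deriv (?G ^ m) = of_nat m * (?G ^ m + ?G ^ k)"
    proof -
      have "fps_deriv (?G ^ m) = of_nat m * (fps_exp 1 * ?G ^ k)"
        unfolding fps_deriv_power Suc by (simp add: mult.assoc flip: fps_of_nat)
      also have "fps_exp 1 * ?G ^ k = ?G ^ m + ?G ^ k"
        by (simp add: Suc algebra_simps)
      finally show ?thesis .
    qed
    hence "fps_deriv (?G ^ m) $ n = of_nat m * (?G ^ m $ n + ?G ^ k $ n)"
      by (metis fps_add_nth fps_mult_left_const_nth fps_of_nat)
    moreover have "fps_deriv (?G ^ m) $ n = of_nat (Suc n) * ?G ^ m $ Suc n"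
      by (simp only: fps_deriv_nth Suc_eq_plus1)
    moreover have "fact m = (of_nat m * fact k :: 'a)"
      and S: "Stirling (Suc n) m = m * Stirling n m + Stirling n k"
      by (simp_all add: Suc)
    ultimately have "of_nat (Suc n) * ?G ^ m $ Suc n =
                     (fact m * of_nat (m * Stirling n m + Stirling n k) / fact n :: 'a)"
      unfolding Suc.IH by (simp add: add_divide_distrib algebra_simps)
    thus ?thesis unfolding S fact_Suc[of n] by (simp add: field_simps del: of_nat_Suc)
  qed auto
qed

lemma fps_R:
  fixes c :: "'a :: field_char_0"
  shows "Abs_fps (\<lambda>m. R m c / fact m) * (1 - fps_X) = fps_exp (c - 1)"
proof -
  \<comment> \<open>The series \<open>D\<close> of the derangement numbers is not computed: it is eliminated by comparing
    with \<open>c = 1\<close>, where \<open>R m 1 = m!\<close>.\<close>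
  define D :: "'a fps" where "D = Abs_fps (\<lambda>k. of_nat (derangements k) / fact k)"
  have R: "Abs_fps (\<lambda>m. R m c / fact m) = fps_exp c * D" for c :: 'a
  proof (rule fps_ext)
    fix m
    have "R m c / fact m = (\<Sum>r=0..m. c ^ r / fact r * (of_nat (derangements (m - r)) / fact (m - r)))"
      unfolding R_def sum_divide_distrib
      by (intro sum.cong refl) (simp add: binomial_fact field_simps)
    thus "Abs_fps (\<lambda>m. R m c / fact m) $ m = (fps_exp c * D) $ m"
      by (simp add: fps_mult_nth D_def)
  qed
  \<comment> \<open>At \<open>c = 1\<close> all coefficients are 1, so the series is
    geometric.\<close>
  have "fps_exp 1 * D * (1 - fps_X) = 1"
    unfolding R[symmetric] R_1
    by (rule fps_ext) (simp add: algebra_simps fps_X_mult_nth split: nat.split)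
  moreover have "fps_exp c = fps_exp (c - 1) * fps_exp 1"
    by (simp add: fps_exp_add_mult[symmetric])
  ultimately show ?thesis unfolding R by (metis mult.assoc mult.right_neutral)
qed

text \<open>The scaled series is \<open>c * X\<close> composed with \<open>G\<close>, so
  associativity of composition moves the scalar into the exponential.\<close>

lemma fps_exp_compose_const_mult:
  fixes G :: "'a :: field_char_0 fps"
  assumes "G $ 0 = 0"
  shows "fps_exp 1 oo (fps_const c * G) = fps_exp c oo G"
proof -
  have "fps_const c * G = (fps_const c * fps_X) oo G"
    using assms by (simp add: fps_compose_mult_distrib)
  hence "fps_exp 1 oo (fps_const c * G) = fps_exp 1 oo (fps_const c * fps_X) oo G"
    using assms by (simp add: fps_compose_assoc)
  thus ?thesis by simp
qed

text \<open>The coefficients of the powers of \<open>e^x - 1\<close> turn the Stirling sum into a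
  composition. Substituting \<open>e^x - 1\<close> in \<open>fps_R\<close> changes
  \<open>1 - X\<close> into \<open>2 - e^x\<close>.\<close>

lemma fps_sum_Stirling_R:
  fixes c :: "'a :: field_char_0"
  shows "Abs_fps (\<lambda>n. (\<Sum>m=0..n. of_nat (Stirling n m) * R m c) / fact n) =
         (fps_exp 1 oo (fps_const (c - 1) * (fps_exp 1 - 1))) / (2 - fps_exp 1)"
proof -
  let ?G = "fps_exp 1 - 1 :: 'a fps"
  let ?H = "Abs_fps (\<lambda>m. R m c / fact m)"
  have eq: "Abs_fps (\<lambda>n. (\<Sum>m=0..n. of_nat (Stirling n m) * R m c) / fact n) = ?H oo ?G"
    by (rule fps_ext)
       (simp add: fps_compose_nth fps_exp_minus_1_power_nth sum_divide_distrib mult.commute)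
  have "(?H oo ?G) * (2 - fps_exp 1) = (?H * (1 - fps_X)) oo ?G"
    by (simp add: fps_compose_mult_distrib fps_compose_sub_distrib)
  hence eq': "(?H oo ?G) * (2 - fps_exp 1) = fps_exp 1 oo (fps_const (c - 1) * ?G)"
    by (simp only: fps_R) (simp add: fps_exp_compose_const_mult)
  have "(2 - fps_exp 1 :: 'a fps) $ 0 \<noteq> 0" by simp
  hence "2 - fps_exp 1 \<noteq> (0 :: 'a fps)" by (metis fps_zero_nth)
  thus ?thesis unfolding eq eq'[symmetric] by (rule nonzero_mult_div_cancel_right[symmetric])
qed

section \<open>Evaluation of polynomial coefficients\<close>

lemma fps_map_nth [simp]: "fps_map f A $ n = f (A $ n)"
  by (simp add: fps_map_def)

lemma fps_map_poly_mult:
  "fps_map (\<lambda>p. poly p c) (A * B) = fps_map (\<lambda>p. poly p c) A * fps_map (\<lambda>p. poly p c) B"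
  by (rule fps_ext) (simp add: fps_mult_nth poly_sum)

lemma fps_map_poly_power:
  "fps_map (\<lambda>p. poly p c) (A ^ n) = fps_map (\<lambda>p. poly p c) A ^ n"
proof (induction n)
  case 0
  show ?case by (rule fps_ext) simp
qed (simp add: fps_map_poly_mult)

lemma fps_map_poly_compose:
  "fps_map (\<lambda>p. poly p c) (A oo B) = fps_map (\<lambda>p. poly p c) A oo fps_map (\<lambda>p. poly p c) B"
  by (rule fps_ext) (simp add: fps_compose_nth poly_sum flip: fps_map_poly_power)

lemma fps_map_poly_diff:
  "fps_map (\<lambda>p. poly p c) (A - B) =
     fps_map (\<lambda>p. poly p c) A - fps_map (\<lambda>p. poly p (c :: 'a :: comm_ring)) B"
  by (rule fps_ext) simp

lemma fps_map_poly_1: "fps_map (\<lambda>p. poly p c) 1 = 1"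
  by (rule fps_ext) simp

lemma fps_map_poly_const: "fps_map (\<lambda>p. poly p c) (fps_const p) = fps_const (poly p c)"
  by (rule fps_ext) simp

lemma fps_map_poly_embed_fps: "fps_map (\<lambda>p. poly p c) (embed_fps A) = A"
  by (rule fps_ext) (simp add: embed_fps_def)

text \<open>Over an integral domain of characteristic 0, which is infinite, a polynomial is
  determined by its values.\<close>

lemma fps_eq_if_fps_map_poly_eq:
  fixes A B :: "'a :: {comm_ring_1, ring_no_zero_divisors, ring_char_0} poly fps"
  assumes "\<And>c. fps_map (\<lambda>p. poly p c) A = fps_map (\<lambda>p. poly p c) B"
  shows "A = B"
proof (rule fps_ext)
  fix n
  have "poly (A $ n) c = poly (B $ n) c" for c
    using arg_cong[OF assms[of c], of "\<lambda>F. F $ n"] by simp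
  thus "A $ n = B $ n" by (simp add: poly_eq_poly_eq_iff[symmetric] fun_eq_iff)
qed

text \<open>Taking \<open>t = 1\<close> in \<open>sum_UPF\<close> removes the displacement.\<close>

lemma fps_map_poly_UPF_egf:
  "fps_map (\<lambda>p. poly p c) UPF_egf =
     Abs_fps (\<lambda>n. (\<Sum>m=0..n. of_nat (Stirling n m) * R m c) / fact n)"
proof (rule fps_ext)
  fix n
  have "(\<Sum>\<alpha>\<in>UPF n. c ^ fix_stat \<alpha>) = (\<Sum>m=0..n. of_nat (Stirling n m) * R m c)"
    using sum_UPF[where u = c and t = 1 and n = n] by simp
  thus "fps_map (\<lambda>p. poly p c) UPF_egf $ n =
        Abs_fps (\<lambda>n. (\<Sum>m=0..n. of_nat (Stirling n m) * R m c) / fact n) $ n"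
    by (simp add: UPF_egf_def poly_sum)
qed

theorem proposition4p5:
  shows
    "(\<forall>n. let u = [:[:0, 1:]:] :: int poly poly; t = [:0, 1:] in
        (\<Sum>\<alpha>\<in>UPF n. u ^ fix_stat \<alpha> * t ^ displacement \<alpha>) =
        (\<Sum>m=0..n. of_nat (Stirling n m) * t ^ (n - m) * R m u))
     \<and> UPF_egf =
        (embed_fps (fps_exp 1) oo (fps_const ([:0, 1:] - 1) * (embed_fps (fps_exp 1) - 1)))
          * embed_fps (1 / (2 - fps_exp 1))
     \<and> fps_map (\<lambda>p. poly p 0) UPF_egf = Abs_fps (\<lambda>n. of_nat (deranged_Bell n) / fact n)
     \<and> Abs_fps (\<lambda>n. of_nat (deranged_Bell n) / fact n) =
        (fps_exp 1 oo (1 - fps_exp 1)) / (2 - fps_exp (1 :: rat))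
     \<and> fps_map (\<lambda>p. poly p 1) UPF_egf = Abs_fps (\<lambda>n. of_nat (Fubini n) / fact n)
     \<and> Abs_fps (\<lambda>n. of_nat (Fubini n) / fact n) = 1 / (2 - fps_exp (1 :: rat))"
proof (intro conjI)
  let ?S = "\<lambda>c :: rat. Abs_fps (\<lambda>n. (\<Sum>m=0..n. of_nat (Stirling n m) * R m c) / fact n)"
  have S_0: "?S 0 = Abs_fps (\<lambda>n. of_nat (deranged_Bell n) / fact n)"
    by (simp add: R_0 deranged_Bell_def mult.commute)
  have S_1: "?S 1 = Abs_fps (\<lambda>n. of_nat (Fubini n) / fact n)"
    by (simp add: R_1 Fubini_def mult.commute)
  \<comment> \<open>Here \<open>u\<close> is the variable of the inner polynomial ring and
    \<open>t\<close> that of the outer one.\<close>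
  show "\<forall>n. let u = [:[:0, 1:]:] :: int poly poly; t = [:0, 1:] in
        (\<Sum>\<alpha>\<in>UPF n. u ^ fix_stat \<alpha> * t ^ displacement \<alpha>) =
        (\<Sum>m=0..n. of_nat (Stirling n m) * t ^ (n - m) * R m u)"
    unfolding Let_def by (intro allI sum_UPF)
  show "UPF_egf =
        (embed_fps (fps_exp 1) oo (fps_const ([:0, 1:] - 1) * (embed_fps (fps_exp 1) - 1)))
          * embed_fps (1 / (2 - fps_exp 1))"
  proof (rule fps_eq_if_fps_map_poly_eq)
    fix c :: rat
    \<comment> \<open>The divisor has constant term 1, so dividing by it is multiplying by its
      inverse.\<close>
    have "(fps_exp 1 oo (fps_const (c - 1) * (fps_exp 1 - 1))) * (1 / (2 - fps_exp 1)) = ?S c"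
      by (simp add: fps_sum_Stirling_R fps_divide_unit)
    thus "fps_map (\<lambda>p. poly p c) UPF_egf = fps_map (\<lambda>p. poly p c)
        ((embed_fps (fps_exp 1) oo (fps_const ([:0, 1:] - 1) * (embed_fps (fps_exp 1) - 1)))
          * embed_fps (1 / (2 - fps_exp 1)))"
      by (simp add: fps_map_poly_UPF_egf fps_map_poly_mult fps_map_poly_compose fps_map_poly_diff
            fps_map_poly_1 fps_map_poly_const fps_map_poly_embed_fps)
  qed
  show "fps_map (\<lambda>p. poly p 0) UPF_egf = Abs_fps (\<lambda>n. of_nat (deranged_Bell n) / fact n)"
    by (simp only: fps_map_poly_UPF_egf S_0)
  have "fps_const (0 - 1) * (fps_exp 1 - 1) = 1 - fps_exp (1 :: rat)"
    by (rule fps_ext) simp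
  thus "Abs_fps (\<lambda>n. of_nat (deranged_Bell n) / fact n) =
        (fps_exp 1 oo (1 - fps_exp 1)) / (2 - fps_exp (1 :: rat))"
    by (simp only: S_0[symmetric] fps_sum_Stirling_R)
  show "fps_map (\<lambda>p. poly p 1) UPF_egf = Abs_fps (\<lambda>n. of_nat (Fubini n) / fact n)"
    by (simp only: fps_map_poly_UPF_egf S_1)
  \<comment> \<open>At \<open>c = 1\<close> the exponent vanishes and the numerator is 1.\<close>
  show "Abs_fps (\<lambda>n. of_nat (Fubini n) / fact n) = 1 / (2 - fps_exp (1 :: rat))"
    unfolding S_1[symmetric] fps_sum_Stirling_R by simp
qed

end
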